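(* Let $b$ be a positive integer with $b\equiv 1\pmod 4$ that is not a perfect square, and let $f_b(x)$ be the inversion polynomial of $b$. Then $-1$ is a double root of $f_b(x)$, i.e. $(x+1)^2$ divides $f_b(x)$. If in addition $3\nmid b$, then every primitive sixth root of unity $\zeta_6$ is also a double root of $f_b(x)$ (a root of multiplicity at least two); that is, $(x^3+1)^2$ divides $f_b(x)$.
   Context: For a permutation $\sigma$ of $\{1,2,\dots,b\}$, its inversion number is $\operatorname{inv}(\sigma)=\#\{(i,j) : 1\le i<j\le b,\ \sigma(i)>\sigma(j)\}$. If $a$ is an integer relatively prime to $b$, let $\sigma_a:\{1,\dots,b\}\to\{1,\dots,b\}$ be the permutation sending $x$ to the unique element of $\{1,\dots,b\}$ congruent to $ax$ modulo $b$, and put $\operatorname{inv}(a,b)=\operatorname{inv}(\sigma_a)$. The inversion polynomial of a positive integer $b$ is $f_b(x)=\sum_{1\le a\le b,\ (a,b)=1} x^{\operatorname{inv}(a,b)}$. "Double root" means a root of multiplicity at least two. *)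

theory Defs
  imports
    "HOL-Number_Theory.Number_Theory"
    "HOL-Computational_Algebra.Computational_Algebra"
    "HOL-Combinatorics.Permutations"
    "HOL.Complex"
begin

definition inversion_number :: "nat \<Rightarrow> (nat \<Rightarrow> nat) \<Rightarrow> nat" where
  "inversion_number b \<sigma> = card {(i, j). 1 \<le> i \<and> i < j \<and> j \<le> b \<and> \<sigma> i > \<sigma> j}"

text \<open>
  Residues are represented in \<open>{1..b}\<close>, so that \<open>b\<close> (not \<open>0\<close>) stands for the zero class.
  Extending by the identity outside \<open>{1..b}\<close> gives a permutation in the sense of
  \<^const>\<open>permutes\<close> whenever \<open>a\<close> is coprime to \<open>b > 0\<close>.
\<close>

definition mult_perm :: "int \<Rightarrow> nat \<Rightarrow> nat \<Rightarrow> nat" where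
  "mult_perm a b x =
     (if x \<in> {1..b} then THE y. y \<in> {1..b} \<and> [int y = a * int x] (mod int b) else x)"

definition inv_mult :: "int \<Rightarrow> nat \<Rightarrow> nat" where
  "inv_mult a b = inversion_number b (mult_perm a b)"

definition inversion_poly :: "nat \<Rightarrow> int poly" where
  "inversion_poly b = (\<Sum>a \<in> {a \<in> {1..b}. coprime a b}. monom 1 (inv_mult (int a) b))"

definition primitive_root_of_unity :: "nat \<Rightarrow> complex \<Rightarrow> bool" where
  "primitive_root_of_unity n z \<longleftrightarrow> n > 0 \<and> z ^ n = 1 \<and> (\<forall>k. 0 < k \<and> k < n \<longrightarrow> z ^ k \<noteq> 1)"

lemma ex1_representative:
  fixes c :: int
  assumes "b > 0"
  shows "\<exists>!y. y \<in> {1..b} \<and> [int y = c] (mod int b)"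
proof -
  let ?r = "nat (c mod int b)"
  let ?y = "if ?r = 0 then b else ?r"
  have r: "int ?r = c mod int b" "?r < b"
    using assms by (simp_all add: nat_less_iff)
  have "?y \<in> {1..b}" "[int ?y = c] (mod int b)"
    using r assms by (auto simp: cong_def intro: antisym)
  moreover have "y = z" if "y \<in> {1..b}" "z \<in> {1..b}" "[int y = c] (mod int b)"
    "[int z = c] (mod int b)" for y z
  proof -
    have "[y = z] (mod b)"
      using that(3,4) by (meson cong_int_iff cong_sym cong_trans)
    then show ?thesis
      using that(1,2) by (auto simp: cong_def mod_if split: if_splits)
  qed
  ultimately show ?thesis by blast
qed

lemma mult_perm_cong:
  assumes "x \<in> {1..b}"
  shows "mult_perm a b x \<in> {1..b}" "[int (mult_perm a b x) = a * int x] (mod int b)"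
proof -
  have "b > 0" using assms by auto
  from theI'[OF ex1_representative[OF this, of "a * int x"]] assms
  show "mult_perm a b x \<in> {1..b}" "[int (mult_perm a b x) = a * int x] (mod int b)"
    by (simp_all add: mult_perm_def)
qed

lemma mult_perm_permutes:
  assumes "b > 0" "coprime a (int b)"
  shows "mult_perm a b permutes {1..b}"
proof (rule bij_imp_permutes)
  have "inj_on (mult_perm a b) {1..b}"
  proof (rule inj_onI)
    fix x y assume xy: "x \<in> {1..b}" "y \<in> {1..b}" "mult_perm a b x = mult_perm a b y"
    then have "[a * int x = a * int y] (mod int b)"
      using mult_perm_cong(2) by (metis cong_sym cong_trans)
    then have "[int x = int y] (mod int b)"
      using assms(2) cong_mult_lcancel by blast
    then show "x = y"
      using ex1_representative[OF assms(1), of "int y"] xy(1,2) cong_refl[of "int y"] by blast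
  qed
  moreover have "mult_perm a b ` {1..b} \<subseteq> {1..b}"
    using mult_perm_cong(1) by blast
  ultimately show "bij_betw (mult_perm a b) {1..b} {1..b}"
    by (simp add: bij_betw_def endo_inj_surj)
next
  show "mult_perm a b x = x" if "x \<notin> {1..b}" for x
    using that by (simp add: mult_perm_def del: atLeastAtMost_iff)
qed

end

theory Submission
  imports Defs
begin

text \<open>
  Write \<open>inv a\<close> for the inversion number of multiplication by \<open>a\<close> modulo \<open>b\<close>, and \<open>A\<close> for the set
  of units modulo \<open>b\<close>, so that the inversion polynomial is \<open>f(x) = (\<Sum>a\<in>A. x ^ inv a)\<close>. A double
  root at \<open>-1\<close> means \<open>f(-1) = f'(-1) = 0\<close>, that is,
  \<open>(\<Sum>a\<in>A. (-1) ^ inv a) = 0\<close> and \<open>(\<Sum>a\<in>A. inv a * (-1) ^ inv a) = 0\<close>.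

  Everything known about \<open>inv a\<close> comes from one identity (\<open>inv_mult_formula\<close>). For \<open>i < j\<close> the
  residues of \<open>a * i\<close> and \<open>a * (j - i)\<close> add up to that of \<open>a * j\<close>, with a carry \<open>b\<close> exactly when
  \<open>(i, j)\<close> is an inversion; summing the carries expresses \<open>b * inv a\<close> through the first moment
  \<open>\<Sum>x<b. x * (a * x mod b)\<close>. Three consequences are used:

  \<^item> \<open>inv a + inv (b - a)\<close> does not depend on \<open>a\<close>, and it is even when \<open>b\<close> is \<open>1\<close> modulo \<open>4\<close>
    (\<open>inv_mult_compl\<close>). Hence \<open>(-1) ^ inv\<close> agrees at \<open>a\<close> and \<open>b - a\<close>, and pairing the two reduces
    the second sum to a multiple of the first.

  \<^item> If \<open>3\<close> does not divide \<open>b\<close> then \<open>3\<close> divides every \<open>inv a\<close> (\<open>three_dvd_inv_mult\<close>), so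
    \<open>f(x) = g(x ^ 3)\<close>. The two sums for the exponents \<open>inv a / 3\<close> vanish as well, because
    division by \<open>3\<close> preserves parity. So \<open>(x + 1) ^ 2\<close> divides \<open>g\<close>, and \<open>(x ^ 3 + 1) ^ 2\<close>
    divides \<open>f\<close>.

  \<^item> For \<open>b\<close> congruent to \<open>1\<close> modulo \<open>4\<close>, \<open>(-1) ^ inv a\<close> is the sign that Gauss's lemma attaches
    to \<open>a\<close> and the half-system of odd residues (\<open>inv_mult_parity\<close>).

  It remains to see that the Gauss signs sum to \<open>0\<close>. They are multiplicative in \<open>a\<close>
  (\<open>gauss_sign_mult\<close>), so it suffices that one of them is \<open>-1\<close> (\<open>ex_gauss_sign_minus_1\<close>). As \<open>b\<close>
  is not a square, \<open>b = p ^ e * m\<close> for a prime \<open>p\<close> not dividing \<open>m\<close> and an odd \<open>e\<close>; take \<open>a\<close> to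
  be a primitive root modulo \<open>p ^ e\<close> and \<open>1\<close> modulo \<open>m\<close>. The residues that are not multiples of
  \<open>m\<close> contribute \<open>1\<close>, which leaves the Gauss sign modulo \<open>p ^ e\<close>, and there each of the \<open>e\<close>
  layers of equal \<open>p\<close>-adic valuation contributes \<open>-1\<close>.
\<close>


section \<open>Multiplication by a unit on residues\<close>

lemma mod_add_residues:
  fixes u v b :: nat
  assumes "u < b" "v < b"
  shows "(u + v) mod b = (if u + v < b then u + v else u + v - b)"
  using assms by (simp add: le_mod_geq)

lemma residues_add_eq_modulus:
  fixes u v b :: nat
  assumes "(u + v) mod b = 0" "u < b" "0 < v" "v < b"
  shows "u + v = b"
  using assms by (simp add: mod_add_residues split: if_splits)

lemma mult_compl_mod:
  fixes a b x :: nat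
  assumes "x \<le> b" "\<not> b dvd a * x"
  shows "a * (b - x) mod b = b - a * x mod b"
proof -
  let ?u = "a * (b - x) mod b" and ?v = "a * x mod b"
  have b: "b > 0" using assms by (cases b) auto
  have "a * (b - x) + a * x = a * b"
    using assms(1) by (metis add.commute add_mult_distrib2 le_add_diff_inverse)
  then have "(?u + ?v) mod b = 0" by (metis mod_add_eq mod_mult_self2_is_0)
  moreover have "0 < ?v" using assms(2) by (simp add: dvd_eq_mod_eq_0)
  moreover have "?u < b" "?v < b" using b by simp_all
  ultimately have "?u + ?v = b" by (intro residues_add_eq_modulus)
  then show ?thesis by simp
qed

lemma coprime_not_dvd_mult:
  fixes a b x :: nat
  assumes "coprime a b" "0 < x" "x < b"
  shows "\<not> b dvd a * x"
  using assms by (metis coprime_commute coprime_dvd_mult_right_iff nat_dvd_not_less)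

lemma coprime_mult_mod_inj:
  fixes a b :: nat
  assumes "coprime a b"
  shows "inj_on (\<lambda>x. a * x mod b) {..<b}"
proof (rule inj_onI)
  fix x y assume "x \<in> {..<b}" "y \<in> {..<b}" "a * x mod b = a * y mod b"
  then show "x = y"
    using assms by (metis cong_def cong_less_modulus_unique_nat cong_mult_lcancel_nat lessThan_iff)
qed

lemma coprime_compl:
  fixes a b :: nat
  assumes "coprime a b" "a < b"
  shows "coprime (b - a) b"
  using assms by (metis coprime_commute coprime_diff_one_left_nat coprime_iff_gcd_eq_1
      gcd_diff1_nat gcd.commute less_imp_le gcd_diff2_nat)

section \<open>Half-systems\<close>

text \<open>
  \<open>H\<close> picks one element from each pair \<open>{x, -x}\<close> of residues in the symmetric set \<open>S\<close>. Negation of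
  a nonzero residue is \<open>b - x\<close>, since residues are represented in \<open>{0..<b}\<close>.
\<close>
definition half_system :: "nat \<Rightarrow> nat set \<Rightarrow> nat set \<Rightarrow> bool" where
  "half_system b S H \<longleftrightarrow>
     S \<subseteq> {0<..<b} \<and> (\<forall>x\<in>S. b - x \<in> S) \<and> H \<subseteq> S \<and> (\<forall>x\<in>S. x \<in> H \<longleftrightarrow> b - x \<notin> H)"

text \<open>
  An even function is a function on pairs \<open>{x, -x}\<close>, so its product does not see which
  representatives were picked. This freedom of choice drives all evaluations of Gauss signs
  below: in each case some half-system other than the odd residues makes the product easy.
\<close>
lemma prod_half_system_eq:
  fixes h :: "nat \<Rightarrow> int"
  assumes H: "half_system b S H" and K: "half_system b S K"
    and even: "\<And>x. x \<in> S \<Longrightarrow> h (b - x) = h x"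
  shows "prod h H = prod h K"
proof -
  define \<phi> where "\<phi> = (\<lambda>x. if x \<in> K then x else b - x)"
  define \<psi> where "\<psi> = (\<lambda>x. if x \<in> H then x else b - x)"
  have S: "b - x \<in> S" "x \<in> H \<longleftrightarrow> b - x \<notin> H" "x \<in> K \<longleftrightarrow> b - x \<notin> K"
    if "x \<in> S" for x
    using H K that unfolding half_system_def by blast+
  have inv: "b - (b - x) = x" if "x \<in> S" for x
    using H that unfolding half_system_def by (meson diff_diff_cancel greaterThanLessThan_iff less_imp_le subsetD)
  have HS: "H \<subseteq> S" and KS: "K \<subseteq> S" using H K unfolding half_system_def by blast+
  show ?thesis
  proof (rule prod.reindex_bij_witness[where i = \<psi> and j = \<phi>])
    fix x assume x: "x \<in> H"
    then have "x \<in> S" using HS by blast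
    with x show "\<psi> (\<phi> x) = x" "\<phi> x \<in> K" "h (\<phi> x) = h x"
      using S[of x] inv[of x] even[of x] by (simp_all add: \<phi>_def \<psi>_def)
  next
    fix x assume x: "x \<in> K"
    then have "x \<in> S" using KS by blast
    with x show "\<phi> (\<psi> x) = x" "\<psi> x \<in> H"
      using S[of x] inv[of x] by (simp_all add: \<phi>_def \<psi>_def)
  qed
qed

text \<open>
  For odd \<open>b\<close> exactly one of \<open>x\<close> and \<open>b - x\<close> is odd.
\<close>
lemma half_system_odd:
  assumes "odd b" "S \<subseteq> {0<..<b}" "\<And>x. x \<in> S \<Longrightarrow> b - x \<in> S"
  shows "half_system b S {x \<in> S. odd x}"
  using assms unfolding half_system_def by auto

section \<open>The sign in Gauss's lemma\<close>

text \<open>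
  For odd \<open>b\<close> this is an odd function on the nonzero residues: it separates the half-system of odd
  residues from its negative.
\<close>
definition parity_sign :: "nat \<Rightarrow> nat \<Rightarrow> int" where
  "parity_sign b y = (if odd (y mod b) then 1 else -1)"

text \<open>
  Gauss's lemma for the half-system of odd residues: the sign counts, modulo two, the elements
  that multiplication by \<open>a\<close> moves out of the half-system. For odd \<open>b\<close> and \<open>a\<close> coprime to \<open>b\<close> this
  is the Jacobi symbol of \<open>a\<close> over \<open>b\<close>.
\<close>
definition gauss_sign :: "nat \<Rightarrow> nat \<Rightarrow> int" where
  "gauss_sign b a = (\<Prod>x | x < b \<and> odd x. parity_sign b (a * x))"

lemma parity_sign_square [simp]: "parity_sign b y * parity_sign b y = 1"
  by (simp add: parity_sign_def)

lemma parity_sign_mult_mod: "parity_sign b (a * (y mod b)) = parity_sign b (a * y)"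
  by (simp add: parity_sign_def mod_mult_right_eq)

lemma parity_sign_mod_left: "parity_sign b (a mod b * y) = parity_sign b (a * y)"
  by (simp add: parity_sign_def mod_mult_left_eq)

lemma gauss_sign_mod: "gauss_sign b (a mod b) = gauss_sign b a"
  by (simp add: gauss_sign_def parity_sign_mod_left)

lemma parity_sign_compl:
  fixes a b x :: nat
  assumes "odd b" "coprime a b" "0 < x" "x < b"
  shows "parity_sign b (a * (b - x)) = - parity_sign b (a * x)"
proof -
  have "\<not> b dvd a * x" using coprime_not_dvd_mult assms by blast
  then have "a * (b - x) mod b = b - a * x mod b" using assms mult_compl_mod by simp
  moreover have "a * x mod b < b" using assms by simp
  ultimately show ?thesis using assms(1) by (auto simp: parity_sign_def)
qed

text \<open>
  Both factors are odd functions of the residue \<open>x\<close>, so their product is even and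
  \<open>prod_half_system_eq\<close> applies to it. On odd residues the factor \<open>parity_sign b x\<close> is \<open>1\<close>, so
  the product over the odd residues is still the Gauss sign of \<open>a\<close>.
\<close>
lemma parity_twist_even:
  fixes a b x :: nat
  assumes "odd b" "coprime a b" "0 < x" "x < b"
  shows "parity_sign b (a * (b - x)) * parity_sign b (b - x)
    = parity_sign b (a * x) * parity_sign b x"
  using parity_sign_compl[OF assms] parity_sign_compl[of b 1 x] assms by simp

text \<open>
  Multiplication by \<open>c\<close> carries the odd residues to another half-system. The even function
  \<open>y \<mapsto> parity_sign b (a * y) * parity_sign b y\<close> has the same product over both: over the odd
  residues it is the sign of \<open>a\<close>, over their image it is the sign of \<open>a * c\<close> times that of \<open>c\<close>.
\<close>
lemma gauss_sign_mult:
  assumes "odd b" "coprime a b" "coprime c b"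
  shows "gauss_sign b (a * c) = gauss_sign b a * gauss_sign b c"
proof -
  let ?S = "{0<..<b}" and ?O = "{x \<in> {0<..<b}. odd x}"
  let ?k = "\<lambda>y. parity_sign b (a * y) * parity_sign b y"
  let ?m = "\<lambda>x. c * x mod b"
  have Oeq: "{x. x < b \<and> odd x} = ?O" by (auto intro: odd_pos)
  have b: "b > 0" using assms(1) by (rule odd_pos)
  have O: "half_system b ?S ?O" using assms(1) by (intro half_system_odd) auto
  have inj: "inj_on ?m ?S"
    using coprime_mult_mod_inj[OF assms(3)] by (rule inj_on_subset) auto
  have injO: "inj_on ?m ?O" using inj by (rule inj_on_subset) auto
  have mS: "?m x \<in> ?S" if "x \<in> ?S" for x
    using that b coprime_not_dvd_mult[OF assms(3), of x]
    by (auto simp: dvd_eq_mod_eq_0)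
  have surj: "?m ` ?S = ?S"
    using inj mS by (intro endo_inj_surj) auto
  have mO: "?m x \<in> ?m ` ?O \<longleftrightarrow> x \<in> ?O" if "x \<in> ?S" for x
    using inj that by (rule inj_on_image_mem_iff) auto
  have neg: "b - ?m x = ?m (b - x)" if "x \<in> ?S" for x
    using that mult_compl_mod[of x b c] coprime_not_dvd_mult[OF assms(3), of x] by auto
  have "half_system b ?S (?m ` ?O)"
    unfolding half_system_def
  proof (intro conjI ballI)
    show "?m ` ?O \<subseteq> ?S" using mS by blast
    fix y assume "y \<in> ?S"
    then obtain x where x: "x \<in> ?S" "y = ?m x" using surj by blast
    then have "b - x \<in> ?S" by auto
    have "(y \<in> ?m ` ?O) = (x \<in> ?O)" using x mO by simp
    moreover have "(b - y \<in> ?m ` ?O) = (b - x \<in> ?O)"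
      using x(2) neg[OF x(1)] mO[OF \<open>b - x \<in> ?S\<close>] by simp
    ultimately show "(y \<in> ?m ` ?O) \<longleftrightarrow> (b - y \<notin> ?m ` ?O)"
      using x(1) assms(1) by auto
  qed auto
  then have eq: "prod ?k (?m ` ?O) = prod ?k ?O"
    by (rule prod_half_system_eq[OF _ O]) (use assms parity_twist_even in auto)
  have "gauss_sign b (a * c) = (\<Prod>x\<in>?O. ?k (?m x) * parity_sign b (c * x))"
    unfolding gauss_sign_def Oeq
  proof (rule prod.cong)
    fix x
    have "parity_sign b (?m x) = parity_sign b (c * x)" by (simp add: parity_sign_def)
    then show "parity_sign b (a * c * x) = ?k (?m x) * parity_sign b (c * x)"
      using parity_sign_mult_mod[of b a "c * x"] by (simp add: mult.assoc)
  qed simp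
  also have "\<dots> = (\<Prod>x\<in>?O. ?k (?m x)) * gauss_sign b c"
    by (simp add: prod.distrib gauss_sign_def Oeq)
  also have "(\<Prod>x\<in>?O. ?k (?m x)) = prod ?k (?m ` ?O)"
    using injO by (simp add: prod.reindex)
  also have "\<dots> = (\<Prod>x\<in>?O. parity_sign b (a * x))"
    unfolding eq by (rule prod.cong) (auto simp: parity_sign_def)
  finally show ?thesis by (simp add: gauss_sign_def Oeq)
qed

section \<open>A unit of Gauss sign -1 for every nonsquare modulus\<close>

definition nonmultiple_gauss_sign :: "nat \<Rightarrow> nat \<Rightarrow> nat \<Rightarrow> int" where
  "nonmultiple_gauss_sign m b a = (\<Prod>x | x < b \<and> odd x \<and> \<not> m dvd x. parity_sign b (a * x))"

text \<open>
  The multiples of \<open>m\<close> modulo \<open>m * n\<close> are a copy of the residues modulo \<open>n\<close>, and scaling by the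
  odd number \<open>m\<close> preserves parity.
\<close>
lemma gauss_sign_split:
  assumes "odd m" "odd n"
  shows "gauss_sign (m * n) a = gauss_sign n a * nonmultiple_gauss_sign m (m * n) a"
proof -
  have m: "m > 0" using assms(1) by (rule odd_pos)
  let ?A = "{x. x < m * n \<and> odd x \<and> m dvd x}" and ?B = "{x. x < m * n \<and> odd x \<and> \<not> m dvd x}"
  have "gauss_sign (m * n) a = (\<Prod>x\<in>?A \<union> ?B. parity_sign (m * n) (a * x))"
    unfolding gauss_sign_def by (rule prod.cong) auto
  also have "\<dots> = (\<Prod>x\<in>?A. parity_sign (m * n) (a * x)) * nonmultiple_gauss_sign m (m * n) a"
    unfolding nonmultiple_gauss_sign_def by (rule prod.union_disjoint) auto
  also have "(\<Prod>x\<in>?A. parity_sign (m * n) (a * x)) = gauss_sign n a"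
    unfolding gauss_sign_def
  proof (rule prod.reindex_bij_witness[where i = "\<lambda>y. m * y" and j = "\<lambda>x. x div m"])
    fix x assume x: "x \<in> ?A"
    then have "m dvd x" by simp
    then obtain y where y: "x = m * y" by (rule dvdE)
    have "odd y" "y < n" using x m unfolding y by simp_all
    then show "m * (x div m) = x" "x div m \<in> {x. x < n \<and> odd x}" using y m by simp_all
    have "a * x mod (m * n) = m * (a * y mod n)"
      unfolding y mult_mod_right by (simp only: mult_ac)
    then show "parity_sign n (a * (x div m)) = parity_sign (m * n) (a * x)"
      using y m assms by (simp add: parity_sign_def)
  next
    fix y assume "y \<in> {x. x < n \<and> odd x}"
    then show "m * y div m = y" "m * y \<in> ?A" using m assms(1) by simp_all
  qed
  finally show ?thesis .
qed

text \<open>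
  Multiplication by \<open>a\<close> fixes every class modulo \<open>m\<close>. It therefore permutes the half-system of
  those \<open>x\<close> whose class modulo \<open>m\<close> is odd; over this half-system the factors
  \<open>parity_sign b (a * x)\<close> and \<open>parity_sign b x\<close> have the same product.
\<close>
lemma nonmultiple_gauss_sign_cong_1:
  assumes "odd b" "m dvd b" "coprime a b" "[a = 1] (mod m)"
  shows "nonmultiple_gauss_sign m b a = 1"
proof -
  let ?S = "{x. x < b \<and> \<not> m dvd x}"
  let ?H = "{x \<in> ?S. odd (x mod m)}" and ?O = "{x \<in> ?S. odd x}"
  let ?h = "\<lambda>x. parity_sign b (a * x) * parity_sign b x"
  have m: "odd m" using assms(1,2) by (metis dvd_trans)
  then have m0: "m > 0" by (rule odd_pos)
  have b: "b > 0" using assms(1) by (rule odd_pos)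
  have S: "?S \<subseteq> {0<..<b}" by (auto intro: gr0I)
  have Sneg: "b - x \<in> ?S" if "x \<in> ?S" for x
  proof -
    have "x > 0" using that S by auto
    moreover have "\<not> m dvd b - x" using that assms(2) dvd_diffD1[of m b x] by auto
    ultimately show ?thesis using b by simp
  qed
  have modneg: "(b - x) mod m = m - x mod m" if "x \<in> ?S" for x
  proof -
    obtain k where k: "b = m * k" using assms(2) by (rule dvdE)
    have "x > 0" using that S by auto
    have "((b - x) mod m + x mod m) mod m = 0"
      unfolding mod_add_eq using that k by simp
    moreover have "x mod m > 0" "x mod m < m" "(b - x) mod m < m"
      using that m0 by (simp_all add: dvd_eq_mod_eq_0)
    ultimately have "(b - x) mod m + x mod m = m" by (intro residues_add_eq_modulus)
    then show ?thesis by simp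
  qed
  have H: "half_system b ?S ?H"
    unfolding half_system_def
  proof (intro conjI ballI)
    fix x assume x: "x \<in> ?S"
    have "x mod m < m" using m0 by simp
    then show "(x \<in> ?H) \<longleftrightarrow> (b - x \<notin> ?H)"
      using x Sneg[OF x] modneg[OF x] m by auto
  qed (use S Sneg in auto)
  have O: "half_system b ?S ?O"
    using assms(1) S Sneg by (rule half_system_odd)
  have inj: "inj_on (\<lambda>x. a * x mod b) ?H"
    using coprime_mult_mod_inj[OF assms(3)] by (rule inj_on_subset) auto
  have mod: "a * x mod b mod m = x mod m" for x
  proof -
    have "a * x mod b mod m = a * x mod m" using assms(2) by (rule mod_mod_cancel)
    also have "\<dots> = x mod m" using cong_mult[OF assms(4) cong_refl[of x]] by (simp add: cong_def)
    finally show ?thesis .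
  qed
  have "(\<lambda>x. a * x mod b) ` ?H \<subseteq> ?H"
    using mod b by (auto simp: dvd_eq_mod_eq_0[of m])
  then have img: "(\<lambda>x. a * x mod b) ` ?H = ?H"
    using inj by (intro endo_inj_surj) auto
  have "nonmultiple_gauss_sign m b a = prod ?h ?O"
    unfolding nonmultiple_gauss_sign_def by (rule prod.cong) (auto simp: parity_sign_def)
  also have "\<dots> = prod ?h ?H"
  proof (rule prod_half_system_eq[OF O H])
    fix x assume "x \<in> ?S"
    then have "0 < x" "x < b" using S by auto
    then show "?h (b - x) = ?h x" by (intro parity_twist_even assms)
  qed
  also have "\<dots> = (\<Prod>x\<in>?H. parity_sign b (a * x mod b)) * (\<Prod>x\<in>?H. parity_sign b x)"
    by (simp add: prod.distrib parity_sign_def)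
  also have "(\<Prod>x\<in>?H. parity_sign b (a * x mod b)) = (\<Prod>x\<in>(\<lambda>x. a * x mod b) ` ?H. parity_sign b x)"
    using inj by (simp add: prod.reindex)
  also have "\<dots> = (\<Prod>x\<in>?H. parity_sign b x)" by (simp only: img)
  also have "(\<Prod>x\<in>?H. parity_sign b x) * (\<Prod>x\<in>?H. parity_sign b x) = 1"
    by (simp flip: prod.distrib)
  finally show ?thesis .
qed

lemma prod_telescope_signs:
  fixes f :: "nat \<Rightarrow> int"
  assumes "\<And>i. f i * f i = 1"
  shows "(\<Prod>i<n. f (Suc i) * f i) = f n * f 0"
proof (induction n)
  case (Suc n)
  have "(\<Prod>i<Suc n. f (Suc i) * f i) = f (Suc n) * (f n * f n) * f 0"
    using Suc by (simp add: mult_ac)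
  then show ?case by (simp add: assms)
qed (simp add: assms)

text \<open>
  The residues prime to \<open>p\<close> are the powers of the primitive root \<open>g\<close>, and \<open>-1\<close> is the power with
  half the maximal exponent, \<open>g ^ k\<close>. So \<open>1, g, ..., g ^ (k - 1)\<close> is a half-system, on which
  multiplication by \<open>g\<close> is a shift. The product telescopes to the ratio of the signs of
  \<open>g ^ k = -1\<close> and \<open>1\<close>.
\<close>
lemma nonmultiple_gauss_sign_primroot:
  assumes p: "prime p" "odd p" and e: "e > 0" and g: "residue_primroot (p ^ e) g"
  shows "nonmultiple_gauss_sign p (p ^ e) g = -1"
proof -
  define b where "b = p ^ e"
  define N where "N = totient b"
  define G where "G = (\<lambda>i. g ^ i mod b)"
  let ?S = "{x. x < b \<and> \<not> p dvd x}"
  let ?h = "\<lambda>x. parity_sign b (g * x) * parity_sign b x"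
  let ?O = "{x \<in> ?S. odd x}"
  have odd_b: "odd b" using p by (simp add: b_def)
  have b1: "b > 1" unfolding b_def using prime_gt_1_nat[OF p(1)] e by (rule one_less_power)
  have pb: "p dvd b" using e by (simp add: b_def)
  have b3: "b > 2" using b1 odd_b by (cases "b = 2") auto
  have cop: "coprime x b \<longleftrightarrow> \<not> p dvd x" for x
    using p e unfolding b_def coprime_power_right_iff
    by (metis coprime_commute not_gr_zero prime_imp_coprime coprime_absorb_left not_prime_unit)
  have coprime_g: "coprime g b"
    using g by (simp add: residue_primroot_def b_def coprime_commute)
  have tot: "totatives b = ?S"
  proof
    show "totatives b \<subseteq> ?S"
      using cop totatives_less[OF _ b1] unfolding in_totatives_iff subset_iff mem_Collect_eq by blast
    show "?S \<subseteq> totatives b"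
    proof
      fix x assume "x \<in> ?S"
      moreover from this have "x \<noteq> 0" by (metis (mono_tags) dvd_0_right mem_Collect_eq)
      ultimately show "x \<in> totatives b" using cop[of x] by (simp add: in_totatives_iff)
    qed
  qed
  have bij: "bij_betw G {..<N} ?S"
    using residue_primroot_is_generator[OF b1] g
    unfolding tot[symmetric] N_def G_def by (simp add: b_def)
  have injG: "inj_on G {..<N}" and img: "G ` {..<N} = ?S"
    using bij by (simp_all only: bij_betw_def)
  have GS: "G i \<in> ?S" if "i < N" for i unfolding img[symmetric] using that by blast
  have inj: "G i = G j \<longleftrightarrow> i = j" if "i < N" "j < N" for i j
    using inj_on_eq_iff[OF injG] that by simp
  have S: "?S \<subseteq> {0<..<b}" by (auto intro: gr0I)
  have Sneg: "b - x \<in> ?S" if "x \<in> ?S" for x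
  proof -
    have "x > 0" using that S by auto
    moreover have "\<not> p dvd b - x" using that pb dvd_diffD1[of p b x] by auto
    ultimately show ?thesis using b1 by simp
  qed
  have "1 \<in> ?S" using p(1) b1 not_prime_unit by auto
  from Sneg[OF this] have "b - 1 \<in> G ` {..<N}" unfolding img .
  then obtain k where k: "k < N" "G k = b - 1" by auto
  \<comment> \<open>\<open>g ^ k\<close> represents \<open>-1\<close>, so adding \<open>k\<close> to an exponent negates the residue.\<close>
  have neg: "G (i + k) = b - G i" if "i < N" for i
  proof -
    have Gi: "0 < G i" "G i < b" using S GS[OF that] by auto
    have "G (i + k) = G i * (b - 1) mod b"
      unfolding k(2)[symmetric] by (simp add: G_def power_add mod_mult_eq)
    also have "\<dots> = b - G i"
      using mult_compl_mod[of 1 b "G i"] Gi b1 nat_dvd_not_less[OF Gi] by simp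
    finally show ?thesis .
  qed
  \<comment> \<open>The square of \<open>-1\<close> is \<open>1\<close>, so the order \<open>N\<close> of \<open>g\<close> divides \<open>2 * k\<close>, and \<open>0 < k < N\<close>.\<close>
  have "k \<noteq> 0" using k(2) b3 b1 by (cases "k = 0") (auto simp: G_def)
  have "G (k + k) = 1" using neg[OF k(1)] k(2) b1 by simp
  then have "[g ^ (k + k) = 1] (mod b)" using b1 by (simp add: G_def cong_def)
  moreover have "ord b g = N" using g by (simp add: residue_primroot_def N_def b_def)
  ultimately have "N dvd k + k" by (simp only: ord_divides)
  then obtain c where c: "k + k = N * c" by (rule dvdE)
  have "c \<noteq> 0" using c \<open>k \<noteq> 0\<close> by (cases "c = 0") simp_all
  moreover have "N * c < N * 2" using c k(1) by linarith
  ultimately have "c = 1" by simp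
  with c have N: "N = k + k" by simp
  have H: "half_system b ?S (G ` {..<k})"
    unfolding half_system_def
  proof (intro conjI ballI)
    show "G ` {..<k} \<subseteq> ?S" using GS k(1) less_trans by blast
    fix x assume "x \<in> ?S"
    then obtain i where i: "i < N" "x = G i" unfolding img[symmetric] by blast
    have mem: "G j \<in> G ` {..<k} \<longleftrightarrow> j < k" if "j < N" for j
      using inj_on_image_mem_iff[OF injG, of j "{..<k}"] that k(1) by simp
    show "(x \<in> G ` {..<k}) \<longleftrightarrow> (b - x \<notin> G ` {..<k})"
    proof (cases "i < k")
      case True
      then have "i + k < N" using N by simp
      then show ?thesis using True mem[of i] mem[of "i + k"] i neg[of i] by simp
    next
      case False
      then have j: "i - k < N" "i - k < k" using i N by auto
      have "G (i - k) < b" using GS[OF j(1)] by simp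
      then have "b - G i = G (i - k)" using neg[OF j(1)] False by simp
      then show ?thesis using False mem[of i] mem[of "i - k"] i j by simp
    qed
  qed (use S Sneg in auto)
  have O: "half_system b ?S ?O"
    using odd_b S Sneg by (rule half_system_odd)
  have "nonmultiple_gauss_sign p b g = prod ?h ?O"
    unfolding nonmultiple_gauss_sign_def by (rule prod.cong) (auto simp: parity_sign_def)
  also have "\<dots> = prod ?h (G ` {..<k})"
  proof (rule prod_half_system_eq[OF O H])
    fix x assume "x \<in> ?S"
    then have "0 < x" "x < b" using S by auto
    then show "?h (b - x) = ?h x" by (intro parity_twist_even odd_b coprime_g)
  qed
  also have "\<dots> = (\<Prod>i<k. ?h (G i))"
  proof (rule prod.reindex_cong[where l = G])
    show "inj_on G {..<k}" using injG by (rule inj_on_subset) (use k(1) in auto)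
  qed auto
  also have "\<dots> = (\<Prod>i<k. parity_sign b (g ^ Suc i) * parity_sign b (g ^ i))"
    by (simp add: G_def parity_sign_def mod_mult_right_eq)
  also have "\<dots> = parity_sign b (g ^ k) * parity_sign b (g ^ 0)"
    by (rule prod_telescope_signs) simp
  also have "\<dots> = -1"
    using k(2) odd_b b1 by (simp add: parity_sign_def G_def)
  finally show ?thesis by (simp add: b_def)
qed

text \<open>
  Splitting off the multiples of \<open>p\<close> lowers the exponent by one and contributes a factor \<open>-1\<close>. For
  this \<open>g\<close> has to be a primitive root modulo all powers of \<open>p\<close> at once.
\<close>
lemma gauss_sign_prime_power:
  assumes "prime p" "odd p" "\<And>k. k > 0 \<Longrightarrow> residue_primroot (p ^ k) g"
  shows "gauss_sign (p ^ e) g = (-1) ^ e"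
proof (induction e)
  case 0
  have none: "{x::nat. x < p ^ 0 \<and> odd x} = {}" by (auto intro: odd_pos)
  show ?case unfolding gauss_sign_def none by simp
next
  case (Suc e)
  have "gauss_sign (p * p ^ e) g
    = gauss_sign (p ^ e) g * nonmultiple_gauss_sign p (p * p ^ e) g"
    using assms(2) by (intro gauss_sign_split) auto
  then show ?case
    using Suc nonmultiple_gauss_sign_primroot[OF assms(1,2) _ assms(3), of "Suc e"] by simp
qed

text \<open>
  An odd exponent in the factorization of \<open>b\<close> makes the sign of a primitive root modulo that prime
  power \<open>-1\<close>. Being \<open>1\<close> modulo the cofactor \<open>m\<close> keeps the rest of \<open>b\<close> from interfering.
\<close>
lemma ex_gauss_sign_minus_1:
  assumes "odd b" "\<not> is_square b"
  obtains a where "coprime a b" "gauss_sign b a = -1"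
proof -
  have b0: "b > 0" using assms(1) by (rule odd_pos)
  obtain p where p: "prime p" "odd (multiplicity p b)"
    using assms(2) by (auto simp: is_nth_power_conv_multiplicity_nat)
  define e where "e = multiplicity p b"
  obtain m where m: "b = p ^ e * m" "\<not> p dvd m"
    unfolding e_def using multiplicity_decompose'[of b p] b0 p(1)
    by (metis not_prime_unit gr_implies_not0)
  have e: "odd e" "e > 0" using p(2) by (auto simp: e_def intro: odd_pos)
  have odds: "odd p" "odd m" using assms(1) m(1) e(2) by auto
  have cop: "coprime (p ^ e) m" using p(1) m(2) by (simp add: prime_imp_coprime)
  obtain g where g: "\<forall>k>0. residue_primroot (p ^ k) g"
    using residue_primroot_odd_prime_power_exists[OF p(1) odds(1)] .
  obtain a where a: "[a = g] (mod p ^ e)" "[a = 1] (mod m)"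
    using binary_chinese_remainder_nat[OF cop] by blast
  have "coprime a (p ^ e)"
    using g e(2) a(1) cong_imp_coprime[OF cong_sym[OF a(1)]]
    by (auto simp: residue_primroot_def coprime_commute)
  moreover have "coprime a m"
    using cong_imp_coprime[OF cong_sym[OF a(2)]] by simp
  ultimately have ab: "coprime a b" by (simp add: m(1))
  have "gauss_sign b a = gauss_sign (p ^ e) a * nonmultiple_gauss_sign m b a"
    using gauss_sign_split[of m "p ^ e" a] odds by (simp add: m(1) mult.commute)
  also have "nonmultiple_gauss_sign m b a = 1"
    using assms(1) ab a(2) by (intro nonmultiple_gauss_sign_cong_1) (simp_all add: m(1))
  also have "gauss_sign (p ^ e) a = gauss_sign (p ^ e) g"
    using gauss_sign_mod[of "p ^ e"] a(1) by (metis cong_def)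
  also have "gauss_sign (p ^ e) g = -1"
    using gauss_sign_prime_power[OF p(1) odds(1), of g e] g e(1) by simp
  finally show ?thesis using that ab by simp
qed

section \<open>The inversion number as a moment of residues\<close>

text \<open>
  The permutation has values in \<open>{1..b}\<close> and a remainder lies in \<open>{0..<b}\<close>; they agree away from
  the zero class.
\<close>
lemma mult_perm_eq_mod:
  assumes "coprime a b" "0 < x" "x < b"
  shows "mult_perm (int a) b x = a * x mod b"
proof -
  have "\<not> b dvd a * x" using assms by (rule coprime_not_dvd_mult)
  then have "0 < a * x mod b" by (simp add: dvd_eq_mod_eq_0[of b])
  moreover have "a * x mod b < b" using assms by simp
  ultimately have "a * x mod b \<in> {1..b}" by simp
  moreover have "[int (a * x mod b) = int a * int x] (mod int b)"
    by (simp add: cong_def zmod_int)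
  moreover have "x \<in> {1..b}" using assms by simp
  moreover have "b > 0" using assms by simp
  ultimately show ?thesis
    using ex1_representative[of b "int a * int x"] mult_perm_cong[of x b "int a"] by blast
qed

text \<open>
  The zero class sits last, at \<open>b\<close>, in the permutation, and first, at \<open>0\<close>, in the remainders. In
  either place it is a fixed extreme point and takes part in no inversion.
\<close>
lemma inv_mult_eq_sum:
  assumes "coprime a b" "b > 0"
  shows "inv_mult (int a) b = (\<Sum>j<b. card {i. i < j \<and> a * j mod b < a * i mod b})"
proof -
  let ?I = "\<lambda>j. {i. i < j \<and> a * j mod b < a * i mod b}"
  let ?\<sigma> = "mult_perm (int a) b"
  have "{(i, j). 1 \<le> i \<and> i < j \<and> j \<le> b \<and> ?\<sigma> i > ?\<sigma> j} = prod.swap ` (SIGMA j:{..<b}. ?I j)"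
    (is "?L = ?R")
  proof (intro equalityI subsetI)
    fix z assume "z \<in> ?L"
    then obtain i j where z: "z = (i, j)" "1 \<le> i" "i < j" "j \<le> b" "?\<sigma> j < ?\<sigma> i" by blast
    have "?\<sigma> i \<le> b" using mult_perm_cong(1)[of i b "int a"] z by auto
    moreover have "?\<sigma> b = b"
    proof -
      have "?\<sigma> b \<in> {1..b}" "[int (?\<sigma> b) = int a * int b] (mod int b)"
        using mult_perm_cong[of b b "int a"] assms(2) by auto
      then show ?thesis
        using ex1_representative[OF assms(2), of "int a * int b"] assms(2)
        by (auto simp: cong_def)
    qed
    ultimately have "j < b" using z by (cases "j = b") auto
    then have "?\<sigma> i = a * i mod b" "?\<sigma> j = a * j mod b"
      using z by (auto intro!: mult_perm_eq_mod assms)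
    then show "z \<in> ?R" using z \<open>j < b\<close> by (auto simp: image_iff)
  next
    fix z assume "z \<in> ?R"
    then obtain i j where z: "z = (i, j)" "i < j" "j < b" "a * j mod b < a * i mod b" by auto
    have "i \<noteq> 0" using z(4) by (cases "i = 0") auto
    then have "?\<sigma> i = a * i mod b" "?\<sigma> j = a * j mod b"
      using z by (auto intro!: mult_perm_eq_mod assms)
    then show "z \<in> ?L" using z \<open>i \<noteq> 0\<close> by auto
  qed
  then have "inv_mult (int a) b = card (SIGMA j:{..<b}. ?I j)"
    unfolding inv_mult_def inversion_number_def by (simp add: card_image)
  then show ?thesis by simp
qed

text \<open>
  The remainders of \<open>a * i\<close> and \<open>a * (j - i)\<close> add up to the remainder of \<open>a * j\<close>, possibly plus
  \<open>b\<close>; the extra \<open>b\<close> occurs exactly when the remainder of \<open>a * j\<close> falls below that of \<open>a * i\<close>.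
\<close>
lemma inversion_indicator:
  fixes a b i j :: nat
  assumes "i < j" "b > 0"
  shows "int b * of_bool (a * j mod b < a * i mod b)
    = int (a * i mod b) + int (a * (j - i) mod b) - int (a * j mod b)"
proof -
  let ?u = "a * i mod b" and ?v = "a * (j - i) mod b"
  have "a * j = a * i + a * (j - i)"
    using assms(1) by (metis add_mult_distrib2 le_add_diff_inverse less_imp_le)
  then have j: "a * j mod b = (?u + ?v) mod b" by (simp add: mod_add_eq)
  have lt: "?u < b" "?v < b" using assms(2) by simp_all
  show ?thesis
  proof (cases "?u + ?v < b")
    case True
    then show ?thesis unfolding j by simp
  next
    case False
    then have "(?u + ?v) mod b = ?u + ?v - b" using mod_add_residues[OF lt] by simp
    then show ?thesis unfolding j using lt False by simp
  qed
qed

lemma sum_reverse_prefix: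
  fixes r :: "nat \<Rightarrow> int"
  assumes "r 0 = 0"
  shows "(\<Sum>i<j. r i + r (j - i) - r j) = 2 * (\<Sum>i<j. r i) + r j - int j * r j"
proof -
  have "(\<Sum>i<j. r (j - i)) = (\<Sum>i<j. r (Suc (j - Suc i)))"
    by (rule sum.cong) (auto simp: Suc_diff_Suc)
  also have "\<dots> = (\<Sum>i<j. r (Suc i))" by (rule sum.nat_diff_reindex)
  also have "\<dots> = (\<Sum>i<j. r i) + r j"
    using sum.lessThan_Suc_shift[of r j] assms by simp
  finally show ?thesis by (simp add: sum.distrib sum_subtractf)
qed

text \<open>
  In the double sum \<open>r i\<close> occurs twice for each of the \<open>n - 1 - i\<close> indices \<open>j\<close> above \<open>i\<close>, and
  \<open>1 - i\<close> times for \<open>j = i\<close>: in total \<open>2 * n - 1 - 3 * i\<close> times.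
\<close>
lemma sum_prefix_sums:
  fixes r :: "nat \<Rightarrow> int"
  shows "(\<Sum>j<n. 2 * (\<Sum>i<j. r i) + r j - int j * r j)
    = (2 * int n - 1) * (\<Sum>i<n. r i) - 3 * (\<Sum>i<n. int i * r i)"
  by (induction n) (simp_all add: algebra_simps)

text \<open>
  For \<open>a\<close> coprime to \<open>b\<close>, the Dedekind sum of \<open>a\<close> and \<open>b\<close> is an affine function of this moment,
  with coefficients depending on \<open>b\<close> only.
\<close>
definition residue_moment :: "nat \<Rightarrow> nat \<Rightarrow> int" where
  "residue_moment b a = (\<Sum>x<b. int x * int (a * x mod b))"

lemma sum_residues:
  fixes a b :: nat
  assumes "coprime a b" "b > 0"
  shows "(\<Sum>x<b. int (a * x mod b)) = (\<Sum>x<b. int x)"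
proof -
  note inj = coprime_mult_mod_inj[OF assms(1)]
  have "(\<lambda>x. a * x mod b) ` {..<b} = {..<b}"
    using assms(2) inj by (intro endo_inj_surj) auto
  then show ?thesis using sum.reindex[OF inj, of int] by simp
qed

lemma double_sum_int: "2 * (\<Sum>x<n. int x) = int n * (int n - 1)"
  by (induction n) (simp_all add: algebra_simps)

text \<open>
  Summing \<open>inversion_indicator\<close> over all \<open>i < j < b\<close> counts each remainder with a weight that is
  affine in its position, which leaves the sum of all remainders (known, since they are just
  permuted) and the first moment.
\<close>
lemma inv_mult_formula:
  fixes a b :: nat
  assumes "coprime a b" "b > 0"
  shows "2 * int b * int (inv_mult (int a) b)
    = (2 * int b - 1) * (int b * (int b - 1)) - 6 * residue_moment b a"
proof -
  define r where "r = (\<lambda>x. int (a * x mod b))"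
  have card: "int (card {i. i < j \<and> a * j mod b < a * i mod b})
      = (\<Sum>i<j. of_bool (a * j mod b < a * i mod b))" for j
    by (simp add: Int_def)
  have "int b * int (inv_mult (int a) b)
      = (\<Sum>j<b. \<Sum>i<j. int b * of_bool (a * j mod b < a * i mod b))"
    unfolding inv_mult_eq_sum[OF assms] of_nat_sum card sum_distrib_left ..
  also have "\<dots> = (\<Sum>j<b. \<Sum>i<j. r i + r (j - i) - r j)"
    using assms(2) by (intro sum.cong refl) (simp add: inversion_indicator r_def)
  also have "\<dots> = (\<Sum>j<b. 2 * (\<Sum>i<j. r i) + r j - int j * r j)"
    by (intro sum.cong refl sum_reverse_prefix) (simp add: r_def)
  also have "\<dots> = (2 * int b - 1) * (\<Sum>x<b. int x) - 3 * residue_moment b a"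
    unfolding sum_prefix_sums using sum_residues[OF assms]
    by (simp add: r_def residue_moment_def)
  finally show ?thesis
    using double_sum_int[of b] by (simp add: algebra_simps)
qed

text \<open>
  In \<open>inv_mult_formula\<close> the moment has coefficient \<open>6\<close>, and when \<open>b\<close> is \<open>1\<close> or \<open>2\<close> modulo \<open>3\<close> the
  remaining term contains the multiple \<open>b - 1\<close> or \<open>2 * b - 1\<close> of \<open>3\<close>.
\<close>
lemma three_dvd_inv_mult:
  assumes "coprime a b" "\<not> 3 dvd b"
  shows "3 dvd inv_mult (int a) b"
proof -
  have b0: "b > 0" using assms(2) by (cases b) auto
  have nb: "\<not> 3 dvd int b" using assms(2) by presburger
  have "3 dvd (2 * int b - 1) * (int b - 1)"
  proof -
    have "3 dvd 2 * int b - 1 \<or> 3 dvd int b - 1" using nb by presburger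
    then show ?thesis by auto
  qed
  then have "3 dvd (2 * int b - 1) * (int b * (int b - 1)) - 6 * residue_moment b a"
    by (intro dvd_diff) (auto simp: mult.left_commute)
  then have "3 dvd (2 * int b) * int (inv_mult (int a) b)"
    unfolding inv_mult_formula[OF assms(1) b0] .
  moreover have "coprime (3::int) (2 * int b)"
  proof -
    have "prime (3::int)" by simp
    moreover have "\<not> 3 dvd 2 * int b" using nb by presburger
    ultimately show ?thesis by (rule prime_imp_coprime)
  qed
  ultimately have "3 dvd int (inv_mult (int a) b)"
    by (simp add: coprime_dvd_mult_right_iff)
  then show ?thesis by presburger
qed

text \<open>
  Replacing \<open>a\<close> by \<open>-a\<close> replaces each nonzero remainder \<open>r\<close> by \<open>b - r\<close>, so the two moments add up
  to a number depending on \<open>b\<close> only.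
\<close>
lemma inv_mult_compl:
  fixes a b :: nat
  assumes "coprime a b" "a < b"
  shows "2 * (int (inv_mult (int a) b) + int (inv_mult (int (b - a)) b))
    = (int b - 1) * (int b - 2)"
proof -
  have b0: "b > 0" using assms(2) by simp
  have cop: "coprime (b - a) b" using assms by (rule coprime_compl)
  have "residue_moment b (b - a) = (\<Sum>x<b. int x * int b - int x * int (a * x mod b))"
    unfolding residue_moment_def
  proof (intro sum.cong refl)
    fix x assume "x \<in> {..<b}"
    show "int x * int ((b - a) * x mod b) = int x * int b - int x * int (a * x mod b)"
    proof (cases "x = 0")
      case False
      then have "\<not> b dvd x * a"
        using coprime_not_dvd_mult[OF assms(1), of x] \<open>x \<in> {..<b}\<close> by (simp add: mult.commute)
      then have "(b - a) * x mod b = b - a * x mod b"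
        using mult_compl_mod[of a b x] assms(2) by (simp add: mult.commute)
      then show ?thesis
        using b0 by (simp add: of_nat_diff right_diff_distrib less_imp_le)
    qed simp
  qed
  then have "residue_moment b (b - a) = int b * (\<Sum>x<b. int x) - residue_moment b a"
    by (simp add: sum_subtractf residue_moment_def sum_distrib_left mult.commute)
  then have mom: "2 * (residue_moment b a + residue_moment b (b - a)) = int b * (int b * (int b - 1))"
    unfolding double_sum_int[symmetric] by simp
  have "int b * (2 * (int (inv_mult (int a) b) + int (inv_mult (int (b - a)) b)))
    = 2 * ((2 * int b - 1) * (int b * (int b - 1)))
      - 3 * (2 * (residue_moment b a + residue_moment b (b - a)))"
    using inv_mult_formula[OF assms(1) b0] inv_mult_formula[OF cop b0]
    by (simp add: algebra_simps)
  also have "\<dots> = int b * ((int b - 1) * (int b - 2))"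
    unfolding mom by (simp add: algebra_simps)
  finally show ?thesis using b0 by simp
qed

lemma card_odd_below: "card {x::nat. x < 2 * n + 1 \<and> odd x} = n"
proof -
  have "{x::nat. x < 2 * n + 1 \<and> odd x} = (\<lambda>i. 2 * i + 1) ` {..<n}"
    by (auto elim!: oddE)
  then show ?thesis by (simp add: card_image inj_on_def)
qed

text \<open>
  For \<open>b = 4 * q + 1\<close> the formula says that \<open>inv_mult a b\<close> has the parity of the moment, which is
  the number of odd \<open>x\<close> with odd remainder. The Gauss sign counts the odd \<open>x\<close> with even remainder
  instead; as there are \<open>2 * q\<close> odd residues altogether, both counts have the same parity.
\<close>
lemma inv_mult_parity:
  assumes "coprime a b" "[b = 1] (mod 4)"
  shows "(-1) ^ inv_mult (int a) b = gauss_sign b a"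
proof -
  obtain q where q: "b = 4 * q + 1"
  proof
    show "b = 4 * (b div 4) + 1" using assms(2) unfolding cong_def by presburger
  qed
  define S where "S = (\<Sum>x<b. x * (a * x mod b))"
  have S: "residue_moment b a = int S" by (simp add: residue_moment_def S_def)
  have "int b * int (inv_mult (int a) b) = 2 * ((2 * int b - 1) * int b * int q) - 3 * int S"
  proof -
    have b: "int b - 1 = 4 * int q" "b > 0" by (simp_all add: q)
    have "2 * int b * int (inv_mult (int a) b)
        = (2 * int b - 1) * (int b * (4 * int q)) - 6 * int S"
      using inv_mult_formula[OF assms(1) b(2)] unfolding b(1) S .
    then have "2 * (int b * int (inv_mult (int a) b))
        = 2 * (2 * ((2 * int b - 1) * int b * int q) - 3 * int S)"
      by (simp add: algebra_simps)
    then show ?thesis by simp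
  qed
  moreover have "odd (int b)" by (simp add: q)
  ultimately have "even (int (inv_mult (int a) b)) \<longleftrightarrow> even (int S)"
    by (metis even_mult_iff even_diff_iff odd_numeral dvd_triv_left even_add even_diff)
  then have "(-1) ^ inv_mult (int a) b = ((-1) ^ S :: int)"
    by (simp add: minus_one_power_iff)
  also have "\<dots> = (\<Prod>x<b. (-1) ^ (x * (a * x mod b)))"
    unfolding S_def by (rule power_sum)
  \<comment> \<open>Even positions contribute even exponents.\<close>
  also have "\<dots> = (\<Prod>x | x < b \<and> odd x. (-1) ^ (x * (a * x mod b)))"
    by (rule prod.mono_neutral_right) auto
  also have "\<dots> = (\<Prod>x | x < b \<and> odd x. (-1) * parity_sign b (a * x))"
    by (rule prod.cong) (auto simp: parity_sign_def minus_one_power_iff)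
  also have "\<dots> = (-1) ^ card {x. x < b \<and> odd x} * gauss_sign b a"
    unfolding prod.distrib gauss_sign_def by simp
  also have "card {x. x < b \<and> odd x} = 2 * q"
    using card_odd_below[of "2 * q"] by (simp add: q)
  finally show ?thesis by simp
qed

section \<open>Signed sums over the units\<close>

text \<open>
  A nontrivial character sums to zero: translation by a unit of sign \<open>-1\<close> negates the sum.
\<close>
lemma sum_gauss_sign:
  assumes "odd b" "\<not> is_square b"
  shows "(\<Sum>a\<in>totatives b. gauss_sign b a) = 0"
proof -
  obtain g where g: "coprime g b" "gauss_sign b g = -1"
    using ex_gauss_sign_minus_1[OF assms] .
  have "b \<noteq> 1" using assms(2) by auto
  then have b1: "b > 1" using odd_pos[OF assms(1)] by simp
  let ?m = "\<lambda>a. g * a mod b" and ?A = "totatives b"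
  have inj: "inj_on ?m ?A"
    using coprime_mult_mod_inj[OF g(1)] by (rule inj_on_subset) (use totatives_less[OF _ b1] in auto)
  have "?m a \<in> ?A" if "a \<in> ?A" for a
  proof -
    have "coprime a b" using that by (simp add: in_totatives_iff)
    then have "coprime (g * a) b" using g(1) by simp
    then have c: "coprime (?m a) b" using b1 by (metis coprime_mod_left_iff not_one_less_zero)
    then have "?m a \<noteq> 0" using b1 by (cases "?m a = 0") auto
    then show ?thesis using c b1 by (simp add: in_totatives_iff less_imp_le)
  qed
  then have img: "?m ` ?A = ?A"
    using inj by (intro endo_inj_surj) auto
  have "(\<Sum>a\<in>?A. gauss_sign b a) = (\<Sum>a\<in>?A. gauss_sign b (?m a))"
    using sum.reindex[OF inj, of "gauss_sign b"] by (simp add: img)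
  also have "\<dots> = (\<Sum>a\<in>?A. gauss_sign b g * gauss_sign b a)"
    using assms(1) g(1) by (intro sum.cong refl)
      (auto simp: gauss_sign_mod gauss_sign_mult in_totatives_iff)
  also have "\<dots> = - (\<Sum>a\<in>?A. gauss_sign b a)"
    by (simp add: g(2) sum_negf)
  finally show ?thesis by simp
qed

text \<open>
  The first sum is the sum of the Gauss signs. In the second, the symmetry \<open>a \<mapsto> b - a\<close> keeps the
  signs and turns the weights \<open>inv_mult a b\<close> into their average, which is constant, so the second
  sum is a multiple of the first.
\<close>
lemma sum_signed_inv_mult:
  assumes "[b = 1] (mod 4)" "\<not> is_square b"
  shows "(\<Sum>a\<in>totatives b. (-1) ^ inv_mult (int a) b) = (0::int)"
    and "(\<Sum>a\<in>totatives b. int (inv_mult (int a) b) * (-1) ^ inv_mult (int a) b) = 0"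
proof -
  let ?A = "totatives b"
  let ?n = "\<lambda>a. inv_mult (int a) b"
  let ?s = "\<lambda>a. (-1) ^ ?n a :: int"
  have "odd b" using assms(1) unfolding cong_def by presburger
  have "b \<noteq> 1" using assms(2) by auto
  then have b1: "b > 1" using odd_pos[OF \<open>odd b\<close>] by simp
  have "(\<Sum>a\<in>?A. ?s a) = (\<Sum>a\<in>?A. gauss_sign b a)"
    using assms(1) by (intro sum.cong refl inv_mult_parity) (auto simp: in_totatives_iff)
  then show sum0: "(\<Sum>a\<in>?A. ?s a) = 0"
    using sum_gauss_sign[OF \<open>odd b\<close> assms(2)] by simp
  obtain q where q: "b = 4 * q + 1"
  proof
    show "b = 4 * (b div 4) + 1" using assms(1) unfolding cong_def by presburger
  qed
  have pair: "int (?n a) + int (?n (b - a)) = 2 * (int q * (4 * int q - 1))" if "a \<in> ?A" for a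
    using inv_mult_compl[of a b] that totatives_less[OF that b1]
    by (simp add: in_totatives_iff q algebra_simps)
  have compl: "b - a \<in> ?A" if "a \<in> ?A" for a
    using that coprime_compl[of a b] totatives_less[OF that b1] by (simp add: in_totatives_iff)
  have sgn: "?s (b - a) = ?s a" if "a \<in> ?A" for a
  proof -
    have "even (int (?n a) + int (?n (b - a)))" using pair[OF that] by simp
    then show ?thesis by (simp add: minus_one_power_iff)
  qed
  have "(\<Sum>a\<in>?A. int (?n a) * ?s a) = (\<Sum>a\<in>?A. int (?n (b - a)) * ?s (b - a))"
    by (rule sum.reindex_bij_witness[where i = "\<lambda>a. b - a" and j = "\<lambda>a. b - a"])
      (use compl totatives_less[OF _ b1] in \<open>auto simp: less_imp_le\<close>)
  also have "\<dots> = (\<Sum>a\<in>?A. int (?n (b - a)) * ?s a)"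
    by (intro sum.cong refl) (simp add: sgn)
  finally have "2 * (\<Sum>a\<in>?A. int (?n a) * ?s a)
      = (\<Sum>a\<in>?A. (int (?n a) + int (?n (b - a))) * ?s a)"
    by (simp add: sum.distrib distrib_right)
  also have "\<dots> = (\<Sum>a\<in>?A. 2 * (int q * (4 * int q - 1)) * ?s a)"
    by (intro sum.cong refl) (simp only: pair)
  also have "\<dots> = 0" using sum0 by (simp flip: sum_distrib_left)
  finally show "(\<Sum>a\<in>?A. int (?n a) * ?s a) = 0" by simp
qed

section \<open>Double roots of the inversion polynomial\<close>

lemma square_dvd_of_double_root:
  fixes p :: "'a :: idom poly"
  assumes "poly p c = 0" "poly (pderiv p) c = 0"
  shows "[:-c, 1:] ^ 2 dvd p"
proof -
  obtain q where q: "p = [:-c, 1:] * q"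
    using assms(1) unfolding poly_eq_0_iff_dvd by (rule dvdE)
  have "poly q c = 0"
    using assms(2) unfolding q pderiv_mult by (simp add: pderiv_pCons)
  then have "[:-c, 1:] dvd q" by (simp add: poly_eq_0_iff_dvd)
  then show ?thesis unfolding q power2_eq_square by (rule mult_dvd_mono[OF dvd_refl])
qed

text \<open>
  The hypotheses say that the polynomial and, up to sign, its derivative vanish at \<open>-1\<close>.
\<close>
lemma square_dvd_sum_monom:
  fixes k :: "'a \<Rightarrow> nat"
  assumes "(\<Sum>a\<in>A. (-1) ^ k a) = (0::int)" "(\<Sum>a\<in>A. int (k a) * (-1) ^ k a) = 0"
  shows "[:1, 1:] ^ 2 dvd (\<Sum>a\<in>A. monom (1::int) (k a))"
proof -
  have "poly (\<Sum>a\<in>A. monom (1::int) (k a)) (-1) = 0"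
    using assms(1) by (simp add: poly_sum poly_monom)
  moreover have "poly (pderiv (\<Sum>a\<in>A. monom (1::int) (k a))) (-1) = 0"
  proof -
    have "int n * (-1) ^ (n - 1) = - (int n * (-1) ^ n)" for n
      by (cases n) auto
    then show ?thesis
      using assms(2) by (simp add: higher_pderiv_sum[of 1, simplified] poly_sum pderiv_monom poly_monom sum_negf)
  qed
  ultimately show ?thesis using square_dvd_of_double_root[of _ "-1::int"] by simp
qed

lemma monom_1_pcompose: "monom 1 n \<circ>\<^sub>p q = q ^ n"
  by (induction n) (simp_all add: monom_Suc pcompose_pCons pcompose_1)

lemma map_poly_of_int_mult:
  "map_poly of_int (p * q) = (map_poly of_int p * map_poly of_int q :: 'a :: comm_ring_1 poly)"
  by (rule poly_eqI) (simp add: coeff_map_poly coeff_mult)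

text \<open>
  The hypothesis \<open>f \<noteq> 0\<close> matters because the order of a root of the zero polynomial is an
  arbitrary number.
\<close>
lemma order_ge_2:
  fixes f r :: "int poly" and z :: complex
  assumes "r ^ 2 dvd f" "f \<noteq> 0" "poly (map_poly of_int r) z = 0"
  shows "order z (map_poly of_int f) \<ge> 2"
proof -
  obtain h where "f = r * r * h" using assms(1) unfolding power2_eq_square by (rule dvdE)
  then have "map_poly of_int f
      = (map_poly of_int r * map_poly of_int r * map_poly of_int h :: complex poly)"
    by (simp add: map_poly_of_int_mult)
  moreover have "[:-z, 1:] dvd map_poly of_int r" using assms(3) by (simp add: poly_eq_0_iff_dvd)
  ultimately have "[:-z, 1:] ^ 2 dvd (map_poly of_int f :: complex poly)"
    unfolding power2_eq_square by (simp only: mult_dvd_mono dvd_mult2)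
  moreover have "(map_poly of_int f :: complex poly) \<noteq> 0"
    using assms(2) by (subst map_poly_eq_0_iff) auto
  ultimately show ?thesis by (simp add: order_divides)
qed

theorem proposition2p3:
  fixes b :: nat
  assumes "b > 0" and "[b = 1] (mod 4)" and "\<not> is_square b"
  shows "(order (-1) (map_poly of_int (inversion_poly b) :: complex poly) \<ge> 2 \<and>
          [:1, 1:] ^ 2 dvd inversion_poly b) \<and>
         (\<not> 3 dvd b \<longrightarrow>
           (\<forall>\<zeta>. primitive_root_of_unity 6 \<zeta> \<longrightarrow>
              order \<zeta> (map_poly of_int (inversion_poly b) :: complex poly) \<ge> 2) \<and>
           (monom 1 3 + 1) ^ 2 dvd inversion_poly b)"
proof (intro conjI impI allI)
  let ?A = "totatives b"
  let ?n = "\<lambda>a. inv_mult (int a) b"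
  have f: "inversion_poly b = (\<Sum>a\<in>?A. monom 1 (?n a))"
    by (simp add: inversion_poly_def totatives_def atLeastSucAtMost_greaterThanAtMost)
  have "1 \<in> ?A" using assms(1) by (simp add: in_totatives_iff)
  moreover have "finite ?A" by simp
  \<comment> \<open>The value at \<open>1\<close> is the number of units.\<close>
  ultimately have "poly (inversion_poly b) 1 \<noteq> 0"
    using assms(1) unfolding f by (auto simp: poly_sum poly_monom)
  then have nz: "inversion_poly b \<noteq> 0" by auto
  show sq: "[:1, 1:] ^ 2 dvd inversion_poly b"
    unfolding f using sum_signed_inv_mult[OF assms(2,3)] by (rule square_dvd_sum_monom)
  show "order (-1) (map_poly of_int (inversion_poly b) :: complex poly) \<ge> 2"
    using sq nz by (rule order_ge_2) (simp add: map_poly_pCons)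
  assume b3: "\<not> 3 dvd b"
  define k where "k = (\<lambda>a. ?n a div 3)"
  have k: "?n a = 3 * k a" if "a \<in> ?A" for a
    using three_dvd_inv_mult[OF _ b3, of a] that by (auto simp: k_def in_totatives_iff)
  have par: "(-1 :: int) ^ ?n a = (-1) ^ k a" if "a \<in> ?A" for a
    using k[OF that] by (simp add: minus_one_power_iff)
  have "(\<Sum>a\<in>?A. (-1) ^ k a) = (0::int)"
    using sum_signed_inv_mult(1)[OF assms(2,3)] par by simp
  moreover have "(\<Sum>a\<in>?A. int (k a) * (-1) ^ k a) = 0"
  proof -
    have "3 * (\<Sum>a\<in>?A. int (k a) * (-1) ^ k a) = (\<Sum>a\<in>?A. int (?n a) * (-1) ^ ?n a)"
      unfolding sum_distrib_left
    proof (intro sum.cong refl)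
      fix a assume a: "a \<in> ?A"
      show "3 * (int (k a) * (-1) ^ k a) = int (?n a) * (-1) ^ ?n a"
        unfolding par[OF a] by (simp add: k[OF a])
    qed
    then show ?thesis using sum_signed_inv_mult(2)[OF assms(2,3)] by simp
  qed
  ultimately have "[:1, 1:] ^ 2 dvd (\<Sum>a\<in>?A. monom (1::int) (k a))"
    by (rule square_dvd_sum_monom)
  then obtain h where h: "(\<Sum>a\<in>?A. monom (1::int) (k a)) = [:1, 1:] ^ 2 * h" by (rule dvdE)
  \<comment> \<open>Substituting \<open>x ^ 3\<close> for \<open>x\<close> turns \<open>x + 1\<close> into \<open>x ^ 3 + 1\<close>.\<close>
  have "inversion_poly b = (\<Sum>a\<in>?A. monom 1 (k a)) \<circ>\<^sub>p monom 1 3"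
    unfolding f pcompose_sum
    by (intro sum.cong refl) (simp add: k monom_1_pcompose monom_power)
  also have "\<dots> = (monom 1 3 + 1) ^ 2 * (h \<circ>\<^sub>p monom 1 3)"
    unfolding h pcompose_mult power2_eq_square by (simp add: pcompose_pCons add.commute one_pCons)
  finally show sq3: "(monom 1 3 + 1) ^ 2 dvd inversion_poly b" by simp
  fix \<zeta> :: complex assume \<zeta>: "primitive_root_of_unity 6 \<zeta>"
  then have "\<zeta> ^ 6 = 1" "\<zeta> ^ 3 \<noteq> 1" by (auto simp: primitive_root_of_unity_def)
  then have "(\<zeta> ^ 3) ^ 2 = 1" by (simp flip: power_mult)
  then have "\<zeta> ^ 3 = -1" using \<open>\<zeta> ^ 3 \<noteq> 1\<close> power2_eq_1_iff by blast
  then have "poly (monom 1 3 + 1) \<zeta> = 0" by (simp add: poly_monom)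
  moreover have "map_poly of_int (monom 1 3 + 1 :: int poly) = (monom 1 3 + 1 :: complex poly)"
    by (rule poly_eqI) (simp add: coeff_map_poly)
  ultimately have "poly (map_poly of_int (monom 1 3 + 1 :: int poly)) \<zeta> = 0" by (simp only:)
  with sq3 nz show "order \<zeta> (map_poly of_int (inversion_poly b) :: complex poly) \<ge> 2"
    by (rule order_ge_2)
qed

end
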